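(* Let the functions $f_i$, $g_i$ satisfy, for every $i\in\mathcal N=\{1,\dots,N\}$: (i) $f_i(\cdot,x_{-i})$ is convex in $x_i$ for every $x_{-i}\in X_{-i}$; (ii) $g_i(x_i,x_{-i},\xi_i)=\xi_i^\top Q_i\xi_i+P_i(x)^\top\xi_i$; (iii) $P_i(x)=A_ix+b_i$ with $A_i\in\mathbb R^{m\times nN}$, $b_i\in\mathbb R^m$; (iv) $Q_i=L_i^\top D_iL_i$ with $L_i$ orthogonal and $D_i$ diagonal positive semidefinite with sorted diagonal entries. Let $(x^\ast,\lambda^\ast)$ be a robust Nash equilibrium of the game $\bar G$. Then $x^\ast$ is a distributionally robust Nash equilibrium of the game $G$.
   Context: Each agent $i\in\mathcal N=\{1,\dots,N\}$ has a decision $x_i\in X_i\subseteq\mathbb R^n$; $x_{-i}\in X_{-i}=\prod_{j\ne i}X_j$ collects the others' decisions and $x=(x_1,\dots,x_N)\in\mathbb R^{nN}$ (also written $(x_i,x_{-i})$). $f_i:\mathbb R^n\times\mathbb R^{n(N-1)}\to\mathbb R$ and $g_i:\mathbb R^n\times\mathbb R^{n(N-1)}\times\mathbb R^m\to\mathbb R$. $\|\cdot\|$ is the Euclidean norm. For each $i$, a radius $\varepsilon_i\ge0$ and samples $\xi_i^{(1)},\dots,\xi_i^{(K_i)}\in\mathbb R^m$ are fixed. The empirical distribution is $\hat{\mathbb P}_{K_i}=\frac1{K_i}\sum_{k_i=1}^{K_i}\delta_{\xi_i^{(k_i)}}$, and $\mathcal P_i=\{\mathbb Q_i \text{ probability measure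 on }\mathbb R^m: d_W(\mathbb Q_i,\hat{\mathbb P}_{K_i})\le\varepsilon_i\}$, where $d_W$ is the 2-Wasserstein metric $d_W(\mathbb Q_1,\mathbb Q_2)=\big(\inf_\Pi\int\|\xi_1-\xi_2\|^2\,\Pi(d\xi_1,d\xi_2)\big)^{1/2}$, the infimum being over couplings $\Pi$ of $\mathbb Q_1,\mathbb Q_2$. Game $G$: each agent $i$ solves $\min_{x_i\in X_i}\max_{\mathbb Q_i\in\mathcal P_i}\{f_i(x_i,x_{-i})+\mathbb E_{\xi_i\sim\mathbb Q_i}[g_i(x_i,x_{-i},\xi_i)]\}$. A point $x^\ast\in\prod_iX_i$ is a distributionally robust Nash equilibrium of $G$ if for all $i\in\mathcal N$, $x_i^\ast\in\arg\min_{x_i\in X_i}\max_{\mathbb Q_i\in\mathcal P_i}\{f_i(x_i,x^\ast_{-i})+\mathbb E_{\xi_i\sim\mathbb Q_i}[g_i(x_i,x^\ast_{-i},\xi_i)]\}$ (the inner max read as a supremum). Game $\bar G$: each agent $i$ solves $\min_{x_i\in X_i,\lambda_i\ge0}J_i(x_i,\lambda_i,x_{-i})$, with $$J_i(x_i,\lambda_i,x_{-i})=f_i(x_i,x_{-i})+\lambda_i\varepsilon_i^2+\frac1{K_i}\sum_{k_i=1}^{K_i}\sup_{\xi_i\in\mathbb R^m}\Big[\xi_i^\top Q_i\xi_i+P_i(x)^\top\xi_i-\lambda_i\|\xi_i-\xi_i^{(k_i)}\|^2\Big].$$ A point $(x^\ast,\lambda^\ast)$, $\lambda^\ast=(\lambda_i^\ast)_{i\in\mathcal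 N}$, is a robust Nash equilibrium of $\bar G$ if for all $i\in\mathcal N$, $(x_i^\ast,\lambda_i^\ast)\in\arg\min_{x_i\in X_i,\lambda_i\ge0}J_i(x_i,\lambda_i,x^\ast_{-i})$. *)

theory Defs
  imports "HOL-Probability.Probability"
begin

section \<open>Wasserstein ambiguity sets\<close>

definition couplings ::
  "'b::euclidean_space measure \<Rightarrow> 'b measure \<Rightarrow> ('b \<times> 'b) measure set" where
  "couplings M1 M2 =
     {T. sets T = sets (borel \<Otimes>\<^sub>M borel) \<and> prob_space T \<and>
         distr T borel fst = M1 \<and> distr T borel snd = M2}"

text \<open>The infimum below may be infinite (measures without a second moment), so the metric
  takes values in \<^typ>\<open>ennreal\<close>; the case distinction is the square root on \<open>[0, \<infinity>]\<close>.\<close>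

definition wasserstein2 ::
  "'b::euclidean_space measure \<Rightarrow> 'b measure \<Rightarrow> ennreal" where
  "wasserstein2 M1 M2 =
     (let c = (INF T \<in> couplings M1 M2. \<integral>\<^sup>+ z. ennreal ((norm (fst z - snd z))\<^sup>2) \<partial>T)
      in if c = \<infinity> then \<infinity> else ennreal (sqrt (enn2real c)))"

text \<open>The empirical distribution is the image of the uniform distribution on the sample indices
  \<open>1, \<dots>, k\<close>, so that coinciding samples are counted with multiplicity.\<close>

definition empirical_measure ::
  "nat \<Rightarrow> (nat \<Rightarrow> 'b::euclidean_space) \<Rightarrow> 'b measure" where
  "empirical_measure k s = distr (uniform_count_measure {1..k}) borel s"

lemma emeasure_empirical_measure:
  assumes "k > 0" "B \<in> sets borel"
  shows "emeasure (empirical_measure k s) B = (1 / real k) * (\<Sum>j=1..k. indicator B (s j))"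
proof -
  have "(\<Sum>j=1..k. indicator B (s j)) = real (card (s -` B \<inter> {1..k}))"
    by (simp add: indicator_def sum.If_cases Int_def vimage_def conj_commute)
  moreover have "s \<in> measurable (uniform_count_measure {1..k}) borel"
    by (simp add: measurable_def space_uniform_count_measure sets_uniform_count_measure)
  ultimately show ?thesis
    using assms
    by (simp add: empirical_measure_def emeasure_distr space_uniform_count_measure
        emeasure_uniform_count_measure)
qed

definition ambiguity_set ::
  "real \<Rightarrow> nat \<Rightarrow> (nat \<Rightarrow> 'b::euclidean_space) \<Rightarrow> 'b measure set" where
  "ambiguity_set \<epsilon> k s =
     {M. sets M = sets borel \<and> prob_space M \<and>
         wasserstein2 M (empirical_measure k s) \<le> ennreal \<epsilon>}"

section \<open>The two games\<close>

text \<open>Agents are the elements of a finite type \<open>'a\<close>, and a profile is a function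
  \<open>x :: 'a \<Rightarrow> real ^ 'n\<close>.  The profile \<open>(y, x\<^sub>-\<^sub>i)\<close> is \<open>x(i := y)\<close>, and a function of
  \<open>(x\<^sub>i, x\<^sub>-\<^sub>i)\<close> is a function of the profile.  In the functions below that take an agent's own
  decision \<open>y\<close>, the value \<open>x i\<close> is overwritten, hence irrelevant.\<close>

definition stack :: "('a::finite \<Rightarrow> real ^ 'n) \<Rightarrow> real ^ ('a \<times> 'n)" where
  "stack x = (\<chi> p. x (fst p) $ snd p)"

text \<open>The worst case is the supremum in \<open>[-\<infinity>, \<infinity>]\<close>.  The expectation is the Bochner integral,
  which is meaningful when the integrand grows at most quadratically: measures in the ambiguity
  set have finite second moments.\<close>

definition worst_case_cost ::
  "('a \<Rightarrow> ('a \<Rightarrow> real ^ 'n) \<Rightarrow> real) \<Rightarrow>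
   ('a \<Rightarrow> ('a \<Rightarrow> real ^ 'n) \<Rightarrow> real ^ 'm \<Rightarrow> real) \<Rightarrow>
   ('a \<Rightarrow> real) \<Rightarrow> ('a \<Rightarrow> nat) \<Rightarrow> ('a \<Rightarrow> nat \<Rightarrow> real ^ 'm) \<Rightarrow>
   'a \<Rightarrow> real ^ 'n \<Rightarrow> ('a \<Rightarrow> real ^ 'n) \<Rightarrow> ereal" where
  "worst_case_cost f g \<epsilon> K s i y x =
     (SUP M \<in> ambiguity_set (\<epsilon> i) (K i) (s i).
        ereal (f i (x(i := y)) + (\<integral>\<xi>. g i (x(i := y)) \<xi> \<partial>M)))"

definition dr_nash_equilibrium ::
  "('a \<Rightarrow> (real ^ 'n) set) \<Rightarrow>
   ('a \<Rightarrow> ('a \<Rightarrow> real ^ 'n) \<Rightarrow> real) \<Rightarrow>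
   ('a \<Rightarrow> ('a \<Rightarrow> real ^ 'n) \<Rightarrow> real ^ 'm \<Rightarrow> real) \<Rightarrow>
   ('a \<Rightarrow> real) \<Rightarrow> ('a \<Rightarrow> nat) \<Rightarrow> ('a \<Rightarrow> nat \<Rightarrow> real ^ 'm) \<Rightarrow>
   ('a \<Rightarrow> real ^ 'n) \<Rightarrow> bool" where
  "dr_nash_equilibrium X f g \<epsilon> K s x \<longleftrightarrow>
     (\<forall>i. x i \<in> X i) \<and>
     (\<forall>i. is_arg_min (\<lambda>y. worst_case_cost f g \<epsilon> K s i y x) (\<lambda>y. y \<in> X i) (x i))"

text \<open>The supremum over \<open>\<xi>\<close> is infinite when the multiplier \<open>l\<close> is too small, so the cost
  is extended-real-valued.\<close>

definition dual_cost ::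
  "('a \<Rightarrow> ('a \<Rightarrow> real ^ 'n) \<Rightarrow> real) \<Rightarrow>
   ('a \<Rightarrow> real ^ 'm ^ 'm) \<Rightarrow> ('a \<Rightarrow> ('a \<Rightarrow> real ^ 'n) \<Rightarrow> real ^ 'm) \<Rightarrow>
   ('a \<Rightarrow> real) \<Rightarrow> ('a \<Rightarrow> nat) \<Rightarrow> ('a \<Rightarrow> nat \<Rightarrow> real ^ 'm) \<Rightarrow>
   'a \<Rightarrow> real ^ 'n \<Rightarrow> real \<Rightarrow> ('a \<Rightarrow> real ^ 'n) \<Rightarrow> ereal" where
  "dual_cost f Q P \<epsilon> K s i y l x =
     ereal (f i (x(i := y)) + l * (\<epsilon> i)\<^sup>2) +
     ereal (1 / real (K i)) *
       (\<Sum>k=1..K i. SUP \<xi>. ereal (\<xi> \<bullet> (Q i *v \<xi>) + P i (x(i := y)) \<bullet> \<xi>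
                                   - l * (norm (\<xi> - s i k))\<^sup>2))"

definition robust_nash_equilibrium ::
  "('a \<Rightarrow> (real ^ 'n) set) \<Rightarrow>
   ('a \<Rightarrow> ('a \<Rightarrow> real ^ 'n) \<Rightarrow> real) \<Rightarrow>
   ('a \<Rightarrow> real ^ 'm ^ 'm) \<Rightarrow> ('a \<Rightarrow> ('a \<Rightarrow> real ^ 'n) \<Rightarrow> real ^ 'm) \<Rightarrow>
   ('a \<Rightarrow> real) \<Rightarrow> ('a \<Rightarrow> nat) \<Rightarrow> ('a \<Rightarrow> nat \<Rightarrow> real ^ 'm) \<Rightarrow>
   ('a \<Rightarrow> real ^ 'n) \<Rightarrow> ('a \<Rightarrow> real) \<Rightarrow> bool" where
  "robust_nash_equilibrium X f Q P \<epsilon> K s x l \<longleftrightarrow>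
     (\<forall>i. is_arg_min (\<lambda>(y, l'). dual_cost f Q P \<epsilon> K s i y l' x)
            (\<lambda>(y, l'). y \<in> X i \<and> 0 \<le> l') (x i, l i))"

section \<open>Matrices\<close>

definition diagonal_matrix :: "real ^ 'm ^ 'm \<Rightarrow> bool" where
  "diagonal_matrix M \<longleftrightarrow> (\<forall>j k. j \<noteq> k \<longrightarrow> M $ j $ k = 0)"

definition positive_semidefinite :: "real ^ 'm ^ 'm \<Rightarrow> bool" where
  "positive_semidefinite M \<longleftrightarrow> transpose M = M \<and> (\<forall>v. 0 \<le> v \<bullet> (M *v v))"

text \<open>Sortedness of the diagonal is relative to the linear order of the index type; either
  direction is admitted.\<close>

definition sorted_diagonal :: "real ^ 'm::{finite,linorder} ^ 'm::{finite,linorder} \<Rightarrow> bool" where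
  "sorted_diagonal M \<longleftrightarrow> mono (\<lambda>j. M $ j $ j) \<or> antimono (\<lambda>j. M $ j $ j)"

end

theory Submission
  imports Defs
begin

text \<open>The equilibrium profile costs agent \<open>i\<close> at most its dual cost (weak duality), the dual cost is
  minimal over all \<open>(y, \<lambda>)\<close>, and for every \<open>y\<close> the infimum of the dual cost over \<open>\<lambda>\<close> is at most the
  worst-case cost (strong duality).  Weak duality integrates a pointwise bound against a nearly
  optimal coupling.  For strong duality with \<open>\<epsilon> > 0\<close>, move the samples by vectors \<open>v\<^sub>j\<close> that maximise
  the total payoff on the sphere of squared radius \<open>K \<epsilon>\<^sup>2\<close>.  Convexity of the payoff forces its gradient at
  the maximiser to be \<open>2 \<lambda> v\<close> with \<open>\<lambda> \<ge> 0\<close>, and reflecting a single \<open>v\<^sub>i \<noteq> 0\<close> on its sphere gives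
  \<open>Q \<le> \<lambda> I\<close>; so every moved sample attains its own dual supremum.  For \<open>\<epsilon> = 0\<close>, let
  \<open>\<lambda> \<rightarrow> \<infinity>\<close>.\<close>

section \<open>Maximising a separable sum on a sphere\<close>

text \<open>This is the extreme value theorem in a space of functions. The index type may be
  infinite, so compactness is obtained by setting the coordinates outside \<open>I\<close> to 0,
  which changes neither the constraint nor the objective; Tychonoff's theorem then applies to the
  product of balls.\<close>

lemma sphere_sum_attains_max:
  fixes F :: "'i \<Rightarrow> 'b::euclidean_space \<Rightarrow> real"
  assumes I: "finite I" "I \<noteq> {}" and R: "R \<ge> 0"
    and F: "\<And>j. j \<in> I \<Longrightarrow> continuous_on UNIV (F j)"
  obtains v where "(\<Sum>j\<in>I. (norm (v j))\<^sup>2) = R"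
    and "\<And>w. (\<Sum>j\<in>I. (norm (w j))\<^sup>2) = R \<Longrightarrow> (\<Sum>j\<in>I. F j (w j)) \<le> (\<Sum>j\<in>I. F j (v j))"
proof -
  \<comment> \<open>The radius \<open>sqrt R\<close> loses nothing, since the constraint bounds each
    single coordinate by it.\<close>
  define B where "B = (\<Pi>\<^sub>E j\<in>(UNIV::'i set). if j \<in> I then cball (0::'b) (sqrt R) else {0})"
  define S where "S = B \<inter> {v. (\<Sum>j\<in>I. (norm (v j))\<^sup>2) = R}"
  have "compactin (product_topology (\<lambda>_. euclidean) UNIV) B"
    unfolding B_def by (simp add: compactin_PiE)
  then have "compact B"
    by (simp add: euclidean_product_topology)
  moreover have "closed {v::'i \<Rightarrow> 'b. (\<Sum>j\<in>I. (norm (v j))\<^sup>2) = R}"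
    by (intro closed_Collect_eq continuous_intros
        continuous_on_product_coordinates)
  ultimately have "compact S"
    unfolding S_def by (rule compact_Int_closed)
  have restrict: "(\<lambda>j. if j \<in> I then w j else 0) \<in> S"
    if w: "(\<Sum>j\<in>I. (norm (w j))\<^sup>2) = R" for w
  proof -
    have "norm (w j) \<le> sqrt R" if "j \<in> I" for j
      using member_le_sum[OF that, of "\<lambda>j. (norm (w j))\<^sup>2"] w I(1) by (simp add: real_le_rsqrt)
    then show ?thesis
      using w by (auto simp: S_def B_def)
  qed
  obtain i where "i \<in> I"
    using I by blast
  obtain e :: 'b where "norm e = 1"
    using norm_Basis nonempty_Basis by blast
  \<comment> \<open>The sphere is nonempty: spend the whole budget \<open>R\<close> on the one
    coordinate \<open>i\<close>.\<close>
  then have "(\<Sum>j\<in>I. (norm (if j = i then sqrt R *\<^sub>R e else 0))\<^sup>2) = R"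
    using I \<open>i \<in> I\<close> R by (simp add: if_distrib[of norm] if_distrib[of "\<lambda>t. t\<^sup>2"] sum.delta cong: if_cong)
  from restrict[OF this] have "S \<noteq> {}"
    by blast
  have "continuous_on S (\<lambda>v. \<Sum>j\<in>I. F j (v j))"
    by (intro continuous_on_sum continuous_on_compose2[OF F] continuous_on_subset[OF continuous_on_product_coordinates]) auto
  from continuous_attains_sup[OF \<open>compact S\<close> \<open>S \<noteq> {}\<close> this]
  obtain v where v: "v \<in> S" "\<And>w. w \<in> S \<Longrightarrow> (\<Sum>j\<in>I. F j (w j)) \<le> (\<Sum>j\<in>I. F j (v j))"
    by blast
  show thesis
  proof
    show "(\<Sum>j\<in>I. (norm (v j))\<^sup>2) = R"
      using v(1) by (simp add: S_def)
    show "(\<Sum>j\<in>I. F j (w j)) \<le> (\<Sum>j\<in>I. F j (v j))" if "(\<Sum>j\<in>I. (norm (w j))\<^sup>2) = R" for w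
      using v(2)[OF restrict[OF that]] by simp
  qed
qed

section \<open>Empirical measures, couplings and ambiguity sets\<close>

lemma measurable_uniform_count_measure_borel:
  "s \<in> measurable (uniform_count_measure A) borel"
  by (simp add: measurable_def space_uniform_count_measure sets_uniform_count_measure)

lemma integral_empirical_measure:
  fixes h :: "'b::euclidean_space \<Rightarrow> real"
  assumes "h \<in> borel_measurable borel"
  shows "(\<integral>\<xi>. h \<xi> \<partial>empirical_measure k s) = (\<Sum>j=1..k. h (s j)) / real k"
  using assms
  by (simp add: empirical_measure_def integral_distr[OF measurable_uniform_count_measure_borel]
      integral_uniform_count_measure)

lemma AE_empirical_measure: "AE w in empirical_measure k s. w \<in> s ` {1..k}"
proof -
  have "{w \<in> space borel. w \<in> s ` {1..k}} \<in> sets borel"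
    by (simp add: finite_imp_closed borel_closed)
  then show ?thesis
    unfolding empirical_measure_def
    by (subst AE_distr_iff[OF measurable_uniform_count_measure_borel]) (auto simp: space_uniform_count_measure intro!: AE_I2)
qed

text \<open>The square root and the infinite case are disposed of here once, so that later arguments
  handle only the infimum of the quadratic transport cost.\<close>

lemma wasserstein2_le_iff:
  assumes "\<epsilon> \<ge> 0"
  shows "wasserstein2 M N \<le> ennreal \<epsilon> \<longleftrightarrow>
    (INF T \<in> couplings M N. \<integral>\<^sup>+ z. ennreal ((norm (fst z - snd z))\<^sup>2) \<partial>T) \<le> ennreal (\<epsilon>\<^sup>2)"
proof -
  define c where "c = (INF T \<in> couplings M N. \<integral>\<^sup>+ z. ennreal ((norm (fst z - snd z))\<^sup>2) \<partial>T)"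
  have "(if c = \<infinity> then \<infinity> else ennreal (sqrt (enn2real c))) \<le> ennreal \<epsilon> \<longleftrightarrow> c \<le> ennreal (\<epsilon>\<^sup>2)"
    using assms by (cases c) (auto simp: top_unique real_sqrt_le_iff' sqrt_le_D real_le_lsqrt)
  then show ?thesis
    by (simp only: wasserstein2_def Let_def c_def)
qed

text \<open>Couple index by index: the joint law of \<open>(t j, s j)\<close> for a uniformly drawn
  \<open>j\<close> has the two empirical measures as marginals, and its cost is the mean squared
  displacement.\<close>

lemma empirical_measure_in_ambiguity_set:
  fixes s t :: "nat \<Rightarrow> 'b::euclidean_space"
  assumes k: "k \<ge> 1" and e: "\<epsilon> \<ge> 0"
    and cost: "(\<Sum>j=1..k. (norm (t j - s j))\<^sup>2) \<le> real k * \<epsilon>\<^sup>2"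
  shows "empirical_measure k t \<in> ambiguity_set \<epsilon> k s"
proof -
  let ?U = "uniform_count_measure {1..k}"
  interpret U: prob_space ?U
    using k by (simp add: prob_space_uniform_count_measure)
  note m = measurable_uniform_count_measure_borel
  define T where "T = distr ?U (borel \<Otimes>\<^sub>M borel) (\<lambda>j. (t j, s j))"
  have mT: "(\<lambda>j. (t j, s j)) \<in> measurable ?U (borel \<Otimes>\<^sub>M borel)"
    using m by measurable
  have "T \<in> couplings (empirical_measure k t) (empirical_measure k s)"
    using U.prob_space_distr[OF mT] mT
    by (simp add: couplings_def T_def empirical_measure_def distr_distr comp_def)
  moreover have "(\<integral>\<^sup>+ z. ennreal ((norm (fst z - snd z))\<^sup>2) \<partial>T) \<le> ennreal (\<epsilon>\<^sup>2)"
  proof -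
    have "(\<integral>\<^sup>+ z. ennreal ((norm (fst z - snd z))\<^sup>2) \<partial>T)
        = (\<integral>\<^sup>+ j. ennreal ((norm (t j - s j))\<^sup>2) \<partial>?U)"
      unfolding T_def by (subst nn_integral_distr[OF mT]) auto
    also have "\<dots> = ennreal (\<Sum>j=1..k. (norm (t j - s j))\<^sup>2 / real k)"
      by (simp add: uniform_count_measure_def nn_integral_point_measure_finite ennreal_mult[symmetric] sum_ennreal)
    also have "\<dots> \<le> ennreal (\<epsilon>\<^sup>2)"
      using cost k by (intro ennreal_leI) (simp add: sum_divide_distrib[symmetric] field_simps)
    finally show ?thesis .
  qed
  ultimately have "wasserstein2 (empirical_measure k t) (empirical_measure k s) \<le> ennreal \<epsilon>"
    unfolding wasserstein2_le_iff[OF e] by (rule INF_lower2)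
  then show ?thesis
    using U.prob_space_distr[OF m] by (simp add: ambiguity_set_def empirical_measure_def)
qed

text \<open>The slack \<delta> yields an actual coupling from a bound on an infimum, without a proof
  that an optimal coupling exists.\<close>

lemma ambiguity_set_near_optimal_coupling:
  assumes M: "M \<in> ambiguity_set \<epsilon> k s" and e: "\<epsilon> \<ge> 0" and d: "\<delta> > 0"
  obtains T where "T \<in> couplings M (empirical_measure k s)"
    and "(\<integral>\<^sup>+ z. ennreal ((norm (fst z - snd z))\<^sup>2) \<partial>T) \<le> ennreal (\<epsilon>\<^sup>2 + \<delta>)"
proof -
  have "(INF T \<in> couplings M (empirical_measure k s).
      \<integral>\<^sup>+ z. ennreal ((norm (fst z - snd z))\<^sup>2) \<partial>T) \<le> ennreal (\<epsilon>\<^sup>2)"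
    using M by (simp add: ambiguity_set_def wasserstein2_le_iff[OF e])
  also have "\<dots> < ennreal (\<epsilon>\<^sup>2 + \<delta>)"
    using d by (simp add: ennreal_lessI add_nonneg_pos)
  finally show thesis
    unfolding INF_less_iff using that less_imp_le by blast
qed

lemma integrable_empirical_measure:
  fixes h :: "'b::euclidean_space \<Rightarrow> real"
  assumes "h \<in> borel_measurable borel"
  shows "integrable (empirical_measure k s) h"
proof -
  have "integrable (uniform_count_measure {1..k}) (\<lambda>j. h (s j))"
    by (simp add: uniform_count_measure_def integrable_point_measure_finite)
  then show ?thesis
    using assms
    by (simp add: empirical_measure_def integrable_distr_eq[OF measurable_uniform_count_measure_borel])
qed

lemma couplings_marginals:
  assumes "T \<in> couplings M N"
  shows "fst \<in> measurable T borel" "snd \<in> measurable T borel"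
    and "distr T borel fst = M" "distr T borel snd = N"
  using assms by (auto simp: couplings_def cong: measurable_cong_sets)

lemma integrable_transport_cost:
  fixes T :: "('b::euclidean_space \<times> 'b) measure"
  assumes T: "T \<in> couplings M N"
    and c: "(\<integral>\<^sup>+ z. ennreal ((norm (fst z - snd z))\<^sup>2) \<partial>T) \<le> ennreal c" "c \<ge> 0"
  shows "integrable T (\<lambda>z. (norm (fst z - snd z))\<^sup>2)"
    and "(\<integral>z. (norm (fst z - snd z))\<^sup>2 \<partial>T) \<le> c"
proof -
  note [measurable] = couplings_marginals(1,2)[OF T]
  show *: "integrable T (\<lambda>z. (norm (fst z - snd z))\<^sup>2)"
    using c(1) by (intro integrableI_bounded) (auto simp: top_unique less_top[symmetric])
  show "(\<integral>z. (norm (fst z - snd z))\<^sup>2 \<partial>T) \<le> c"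
    using c nn_integral_eq_integral[OF *] by simp
qed

text \<open>The second moment of \<open>M\<close> is controlled by that of the finitely supported
  empirical measure plus the transport cost of some coupling of finite cost.\<close>

lemma ambiguity_set_integrable_norm_square:
  fixes M :: "'b::euclidean_space measure"
  assumes M: "M \<in> ambiguity_set \<epsilon> k s" and e: "\<epsilon> \<ge> 0"
  shows "integrable M (\<lambda>\<xi>. (norm \<xi>)\<^sup>2)"
proof -
  obtain T where T: "T \<in> couplings M (empirical_measure k s)"
    and c: "(\<integral>\<^sup>+ z. ennreal ((norm (fst z - snd z))\<^sup>2) \<partial>T) \<le> ennreal (\<epsilon>\<^sup>2 + 1)"
    using ambiguity_set_near_optimal_coupling[OF M e, of 1] by auto
  note [measurable] = couplings_marginals(1,2)[OF T]
  have "integrable (empirical_measure k s) (\<lambda>w. (norm w)\<^sup>2)"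
    by (rule integrable_empirical_measure) measurable
  then have "integrable T (\<lambda>z. (norm (snd z))\<^sup>2)"
    by (simp add: couplings_marginals(4)[OF T, symmetric] integrable_distr_eq)
  moreover have "integrable T (\<lambda>z. (norm (fst z - snd z))\<^sup>2)"
    using integrable_transport_cost(1)[OF T c] by simp
  ultimately have "integrable T (\<lambda>z. 2 * (norm (fst z - snd z))\<^sup>2 + 2 * (norm (snd z))\<^sup>2)"
    by simp
  then have "integrable T (\<lambda>z. (norm (fst z))\<^sup>2)"
  proof (rule Bochner_Integration.integrable_bound)
    have "(norm (a :: 'b))\<^sup>2 \<le> 2 * (norm (a - b))\<^sup>2 + 2 * (norm b)\<^sup>2" for a b
    proof -
      \<comment> \<open>The difference of the two sides of the claim is exactly this square.\<close>
      have "0 \<le> (a - 2 *\<^sub>R b) \<bullet> (a - 2 *\<^sub>R b)"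
        by (rule inner_ge_zero)
      then show ?thesis
        by (simp add: power2_norm_eq_inner algebra_simps inner_commute)
    qed
    then show "AE z in T. norm ((norm (fst z))\<^sup>2) \<le> norm (2 * (norm (fst z - snd z))\<^sup>2 + 2 * (norm (snd z))\<^sup>2)"
      by simp
  qed measurable
  then show ?thesis
    by (simp add: couplings_marginals(3)[OF T, symmetric] integrable_distr_eq)
qed

section \<open>Weak duality\<close>

text \<open>Integrate \<open>bound\<close> against a coupling of cost at most
  \<open>\<epsilon>\<^sup>2 + \<delta>\<close>. The first marginal produces the expectation under
  \<open>M\<close>, the second the sample average of \<phi>; afterwards \<delta> tends to 0.\<close>

lemma weak_duality:
  fixes h :: "'b::euclidean_space \<Rightarrow> real"
  assumes M: "M \<in> ambiguity_set \<epsilon> k s" and e: "\<epsilon> \<ge> 0" and l: "l \<ge> 0"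
    and h: "integrable M h" "h \<in> borel_measurable borel"
    and bound: "\<And>\<xi> w. w \<in> s ` {1..k} \<Longrightarrow> h \<xi> \<le> \<phi> w + l * (norm (\<xi> - w))\<^sup>2"
  shows "(\<integral>\<xi>. h \<xi> \<partial>M) \<le> l * \<epsilon>\<^sup>2 + (\<Sum>j=1..k. \<phi> (s j)) / real k"
proof -
  \<comment> \<open>Nothing is known about the measurability of \<phi>. Its restriction to the
    finite sample set, extended by 0, is measurable and agrees with \<phi> almost everywhere for the
    empirical marginal.\<close>
  define \<psi> where "\<psi> w = (\<Sum>u\<in>s ` {1..k}. \<phi> u * indicator {u} w)" for w
  have \<psi>_eq: "\<psi> w = \<phi> w" if "w \<in> s ` {1..k}" for w
  proof -
    have "\<psi> w = (\<Sum>u\<in>s ` {1..k}. if u = w then \<phi> u else 0)"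
      unfolding \<psi>_def by (intro sum.cong) (auto simp: indicator_def)
    then show ?thesis
      using that by simp
  qed
  have \<psi>_meas [measurable]: "\<psi> \<in> borel_measurable borel"
    unfolding \<psi>_def by measurable
  have "(\<integral>\<xi>. h \<xi> \<partial>M) \<le> l * (\<epsilon>\<^sup>2 + \<delta>) + (\<Sum>j=1..k. \<phi> (s j)) / real k" if \<delta>: "\<delta> > 0" for \<delta>
  proof -
    obtain T where T: "T \<in> couplings M (empirical_measure k s)"
      and c: "(\<integral>\<^sup>+ z. ennreal ((norm (fst z - snd z))\<^sup>2) \<partial>T) \<le> ennreal (\<epsilon>\<^sup>2 + \<delta>)"
      using ambiguity_set_near_optimal_coupling[OF M e \<delta>] .
    note T_meas [measurable] = couplings_marginals(1,2)[OF T]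
    note [measurable] = h(2)
    have cost: "integrable T (\<lambda>z. (norm (fst z - snd z))\<^sup>2)"
      "(\<integral>z. (norm (fst z - snd z))\<^sup>2 \<partial>T) \<le> \<epsilon>\<^sup>2 + \<delta>"
      using integrable_transport_cost[OF T c] \<delta> by simp_all
    have h_fst: "integrable T (\<lambda>z. h (fst z))" "(\<integral>\<xi>. h \<xi> \<partial>M) = (\<integral>z. h (fst z) \<partial>T)"
      using h(1) by (simp_all add: couplings_marginals(3)[OF T, symmetric] integrable_distr_eq integral_distr)
    have \<psi>_snd: "integrable T (\<lambda>z. \<psi> (snd z))"
      using integrable_empirical_measure[OF \<psi>_meas, of k s]
      by (simp add: couplings_marginals(4)[OF T, symmetric] integrable_distr_eq)
    have "(\<integral>z. \<psi> (snd z) \<partial>T) = (\<integral>w. \<psi> w \<partial>empirical_measure k s)"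
      by (simp add: couplings_marginals(4)[OF T, symmetric] integral_distr)
    also have "\<dots> = (\<Sum>j=1..k. \<phi> (s j)) / real k"
      by (simp add: integral_empirical_measure \<psi>_eq)
    finally have \<psi>_int: "(\<integral>z. \<psi> (snd z) \<partial>T) = (\<Sum>j=1..k. \<phi> (s j)) / real k" .
    have "AE w in distr T borel snd. w \<in> s ` {1..k}"
      unfolding couplings_marginals(4)[OF T] by (rule AE_empirical_measure)
    then have "AE z in T. snd z \<in> s ` {1..k}"
      by (rule AE_distrD[OF T_meas(2)])
    then have "AE z in T. h (fst z) \<le> \<psi> (snd z) + l * (norm (fst z - snd z))\<^sup>2"
      by (rule AE_mp) (simp add: \<psi>_eq bound)
    then have "(\<integral>z. h (fst z) \<partial>T) \<le> (\<integral>z. \<psi> (snd z) + l * (norm (fst z - snd z))\<^sup>2 \<partial>T)"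
      using h_fst \<psi>_snd cost by (intro integral_mono_AE) auto
    also have "\<dots> = (\<Sum>j=1..k. \<phi> (s j)) / real k + l * (\<integral>z. (norm (fst z - snd z))\<^sup>2 \<partial>T)"
      using \<psi>_snd cost by (simp add: \<psi>_int)
    also have "\<dots> \<le> (\<Sum>j=1..k. \<phi> (s j)) / real k + l * (\<epsilon>\<^sup>2 + \<delta>)"
      using cost(2) l by (intro add_left_mono mult_left_mono)
    finally show ?thesis
      by (simp add: h_fst(2))
  qed
  then have le: "(\<integral>\<xi>. h \<xi> \<partial>M) \<le> l * \<epsilon>\<^sup>2 + (\<Sum>j=1..k. \<phi> (s j)) / real k + l * \<delta>" if "\<delta> > 0" for \<delta>
    using that by (simp add: algebra_simps)
  show ?thesis
  proof (rule field_le_epsilon)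
    fix \<eta> :: real
    assume "\<eta> > 0"
    \<comment> \<open>Take \<delta> to be \<open>\<eta> / (l + 1)\<close>; the added 1 keeps the
      quotient defined for \<open>l = 0\<close>.\<close>
    then have "l * (\<eta> / (l + 1)) \<le> \<eta>" "\<eta> / (l + 1) > 0"
      using l by (simp_all add: field_simps)
    with le show "(\<integral>\<xi>. h \<xi> \<partial>M) \<le> l * \<epsilon>\<^sup>2 + (\<Sum>j=1..k. \<phi> (s j)) / real k + \<eta>"
      by fastforce
  qed
qed

section \<open>Multipliers for quadratic payoffs\<close>

text \<open>These are the global optimality conditions of a trust-region problem whose constraint
  couples all samples: stationarity together with the curvature bound
  \<open>e \<bullet> q e \<le> l * (e \<bullet> e)\<close>. They suffice because the payoff equals
  its second-order expansion.\<close>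

lemma trust_region_multiplier:
  fixes q :: "'b::euclidean_space \<Rightarrow> 'b"
  assumes lin: "bounded_linear q" and sym: "\<And>u v. u \<bullet> q v = q u \<bullet> v"
    and psd: "\<And>v. 0 \<le> v \<bullet> q v"
    and I: "finite I" "I \<noteq> {}" and R: "R > 0"
  obtains l t where "l \<ge> 0" and "(\<Sum>j\<in>I. (norm (t j - s j))\<^sup>2) = R"
    and "\<And>j \<xi>. j \<in> I \<Longrightarrow> \<xi> \<bullet> q \<xi> + p \<bullet> \<xi> - l * (norm (\<xi> - s j))\<^sup>2
      \<le> t j \<bullet> q (t j) + p \<bullet> t j - l * (norm (t j - s j))\<^sup>2"
proof -
  interpret q: bounded_linear q
    by (rule lin)
  define h where "h \<xi> = \<xi> \<bullet> q \<xi> + p \<bullet> \<xi>" for \<xi>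
  have h_add: "h (\<xi> + d) = h \<xi> + (p + 2 *\<^sub>R q \<xi>) \<bullet> d + d \<bullet> q d" for \<xi> d
  proof -
    have "d \<bullet> q \<xi> = q \<xi> \<bullet> d" "\<xi> \<bullet> q d = q \<xi> \<bullet> d"
      by (rule inner_commute, rule sym)
    then show ?thesis
      by (simp add: h_def q.add inner_add_left inner_add_right)
  qed
  have "continuous_on UNIV (\<lambda>u. h (s j + u))" for j
    unfolding h_def by (intro continuous_intros q.continuous_on)
  then obtain v where v: "(\<Sum>j\<in>I. (norm (v j))\<^sup>2) = R"
    and v_max: "\<And>w. (\<Sum>j\<in>I. (norm (w j))\<^sup>2) = R \<Longrightarrow>
      (\<Sum>j\<in>I. h (s j + w j)) \<le> (\<Sum>j\<in>I. h (s j + v j))"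
    using sphere_sum_attains_max[OF I less_imp_le[OF R], of "\<lambda>j u. h (s j + u)"] by blast
  define a where "a j = p + 2 *\<^sub>R q (s j + v j)" for j
  have h_diff: "h (s j + w) = h (s j + v j) + a j \<bullet> (w - v j) + (w - v j) \<bullet> q (w - v j)" for j w
    using h_add[of "s j + v j" "w - v j"] by (simp add: a_def)
  \<comment> \<open>Dropping the nonnegative quadratic term shows that \<open>v\<close> also
    maximises the linearised payoff on the sphere.\<close>
  have grad: "(\<Sum>j\<in>I. a j \<bullet> w j) \<le> (\<Sum>j\<in>I. a j \<bullet> v j)" if "(\<Sum>j\<in>I. (norm (w j))\<^sup>2) = R" for w
  proof -
    have "(\<Sum>j\<in>I. h (s j + v j) + (a j \<bullet> w j - a j \<bullet> v j)) \<le> (\<Sum>j\<in>I. h (s j + w j))"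
      by (intro sum_mono) (simp add: h_diff[of _ "w _"] inner_diff_right psd)
    with v_max[OF that] show ?thesis
      by (simp add: sum.distrib sum_subtractf)
  qed
  \<comment> \<open>If the stacked gradient \<open>a\<close> is a nonnegative multiple of
    \<open>v\<close>, the factor has to be this ratio of their norms.\<close>
  define c where "c = sqrt ((\<Sum>j\<in>I. (norm (a j))\<^sup>2) / R)"
  have c: "c \<ge> 0" "c\<^sup>2 * R = (\<Sum>j\<in>I. (norm (a j))\<^sup>2)"
    using R by (simp_all add: c_def sum_nonneg)
  \<comment> \<open>Equality in Cauchy-Schwarz: the gradient \<open>a\<close> itself, rescaled to the sphere, is a competitor.\<close>
  have cv: "c * (c * R) \<le> c * (\<Sum>j\<in>I. a j \<bullet> v j)"
  proof (cases "c = 0")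
    case False
    have "(\<Sum>j\<in>I. (norm (a j /\<^sub>R c))\<^sup>2) = (\<Sum>j\<in>I. (norm (a j))\<^sup>2) / c\<^sup>2"
      by (simp add: sum_distrib_left power_mult_distrib divide_inverse power_inverse mult.commute)
    also have "\<dots> = R"
      using False by (simp add: c(2)[symmetric])
    finally have "(\<Sum>j\<in>I. (norm (a j /\<^sub>R c))\<^sup>2) = R" .
    from grad[OF this] have "(\<Sum>j\<in>I. (norm (a j))\<^sup>2) / c \<le> (\<Sum>j\<in>I. a j \<bullet> v j)"
      by (simp add: power2_norm_eq_inner sum_distrib_left divide_inverse mult.commute)
    moreover have "(\<Sum>j\<in>I. (norm (a j))\<^sup>2) / c = c * R"
      unfolding c(2)[symmetric] using False by (simp add: power2_eq_square)
    ultimately show ?thesis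
      using c(1) by (intro mult_left_mono) auto
  qed simp
  \<comment> \<open>Expanding the squared distance between \<open>a\<close> and \<open>c\<close>
    times \<open>v\<close> leaves a quantity that \<open>cv\<close> makes nonpositive, so the two
    coincide.\<close>
  have "(\<Sum>j\<in>I. (norm (a j - c *\<^sub>R v j))\<^sup>2)
      = (\<Sum>j\<in>I. (norm (a j))\<^sup>2 - 2 * (c * (a j \<bullet> v j)) + c\<^sup>2 * (norm (v j))\<^sup>2)"
    unfolding power2_norm_eq_inner
    by (intro sum.cong refl) (simp add: inner_commute algebra_simps power2_eq_square)
  also have "\<dots> = c\<^sup>2 * R - 2 * (c * (\<Sum>j\<in>I. a j \<bullet> v j)) + c\<^sup>2 * R"
    by (simp add: sum.distrib sum_subtractf sum_distrib_left[symmetric] c(2) v)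
  also have "\<dots> \<le> 0"
    using cv by (simp add: power2_eq_square mult_ac)
  finally have "(\<Sum>j\<in>I. (norm (a j - c *\<^sub>R v j))\<^sup>2) = 0"
    by (intro antisym sum_nonneg) auto
  then have a_eq: "a j = c *\<^sub>R v j" if "j \<in> I" for j
    using that I(1) by (simp add: sum_nonneg_eq_0_iff)
  obtain i where i: "i \<in> I" "v i \<noteq> 0"
    using v R by (metis (mono_tags, lifting) norm_zero sum.neutral less_irrefl zero_eq_power2)
  have curv_transversal: "e \<bullet> q e \<le> c / 2 * (e \<bullet> e)" if e: "e \<bullet> v i \<noteq> 0" for e
  proof -
    have "e \<bullet> e \<noteq> 0"
      using e by auto
    \<comment> \<open>The step along \<open>e\<close> from \<open>v i\<close> to the other point of the line on the sphere.\<close>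
    define \<tau> where "\<tau> = - 2 * (e \<bullet> v i) / (e \<bullet> e)"
    have \<tau>: "\<tau> \<noteq> 0" "2 * (e \<bullet> v i) = - \<tau> * (e \<bullet> e)"
      using e \<open>e \<bullet> e \<noteq> 0\<close> by (auto simp: \<tau>_def)
    define w where "w = v(i := v i + \<tau> *\<^sub>R e)"
    have "(norm (v i + \<tau> *\<^sub>R e))\<^sup>2 = (norm (v i))\<^sup>2 + \<tau> * (2 * (e \<bullet> v i)) + \<tau>\<^sup>2 * (e \<bullet> e)"
      unfolding power2_norm_eq_inner by (simp add: inner_commute algebra_simps power2_eq_square)
    also have "\<dots> = (norm (v i))\<^sup>2"
      unfolding \<tau>(2) by (simp add: power2_eq_square)
    finally have "(\<Sum>j\<in>I. (norm (w j))\<^sup>2) = R"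
      unfolding v[symmetric] w_def by (intro sum.cong) auto
    from v_max[OF this] have "h (s i + w i) \<le> h (s i + v i)"
      using I(1) i(1) by (simp add: sum.remove[of I i] w_def)
    then have "c * (\<tau> * (e \<bullet> v i)) + \<tau>\<^sup>2 * (e \<bullet> q e) \<le> 0"
      using h_diff[of i "w i"]
      by (simp add: w_def a_eq[OF i(1)] q.scaleR power2_eq_square inner_commute mult.assoc)
    \<comment> \<open>The choice of \<tau> makes the first-order term a multiple of
      \<open>\<tau>\<^sup>2\<close> too, so that this factor cancels and a bound on the curvature
      remains.\<close>
    moreover have "c * (\<tau> * (e \<bullet> v i)) = - (\<tau>\<^sup>2 * (c / 2 * (e \<bullet> e)))"
      using arg_cong[OF \<tau>(2), of "\<lambda>r. c * \<tau> * r / 2"] by (simp add: power2_eq_square)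
    ultimately have "\<tau>\<^sup>2 * (e \<bullet> q e) \<le> \<tau>\<^sup>2 * (c / 2 * (e \<bullet> e))"
      by simp
    then show ?thesis
      using \<tau>(1) by (simp add: mult_le_cancel_left)
  qed
  have curv: "e \<bullet> q e \<le> c / 2 * (e \<bullet> e)" for e
  proof (cases "e \<bullet> v i = 0")
    case True
    \<comment> \<open>A direction orthogonal to \<open>v i\<close> is tangent to the sphere and has
      no second intersection point. Tilting it by \<open>r *\<^sub>R v i\<close> makes it
      transversal; then let \<open>r\<close> tend to 0.\<close>
    define D where "D r = (e + r *\<^sub>R v i) \<bullet> q (e + r *\<^sub>R v i) - c / 2 * ((e + r *\<^sub>R v i) \<bullet> (e + r *\<^sub>R v i))" for r
    have "isCont D 0"
      unfolding D_def by (intro continuous_intros q.isCont)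
    then have "(D \<longlongrightarrow> D 0) (at 0)"
      by (simp add: isCont_def)
    moreover have "D r \<le> 0" if "r \<noteq> 0" for r
    proof -
      have "(e + r *\<^sub>R v i) \<bullet> v i \<noteq> 0"
        using True i(2) that by (simp add: inner_add_left)
      from curv_transversal[OF this] show ?thesis
        by (simp add: D_def)
    qed
    then have "\<forall>\<^sub>F r in at 0. D r \<le> 0"
      by (simp add: eventually_at_filter)
    ultimately have "D 0 \<le> 0"
      by (rule tendsto_upperbound) simp
    then show ?thesis
      by (simp add: D_def)
  qed (rule curv_transversal)
  show thesis
  \<comment> \<open>The penalty with multiplier \<open>c / 2\<close> has gradient
    \<open>c *\<^sub>R v j\<close> at the moved sample, which cancels the linear term of the payoff;
    \<open>curv\<close> controls the rest.\<close>
  proof (rule that[of "c / 2" "\<lambda>j. s j + v j"])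
    fix j \<xi>
    assume j: "j \<in> I"
    define d where "d = \<xi> - s j - v j"
    have "h \<xi> = h (s j + v j) + c * (v j \<bullet> d) + d \<bullet> q d"
      using h_diff[of j "\<xi> - s j"] by (simp add: d_def a_eq[OF j])
    moreover have "(norm (\<xi> - s j))\<^sup>2 = (norm (v j))\<^sup>2 + 2 * (v j \<bullet> d) + d \<bullet> d"
      by (simp add: d_def power2_norm_eq_inner inner_commute algebra_simps)
    ultimately show "\<xi> \<bullet> q \<xi> + p \<bullet> \<xi> - c / 2 * (norm (\<xi> - s j))\<^sup>2
        \<le> (s j + v j) \<bullet> q (s j + v j) + p \<bullet> (s j + v j) - c / 2 * (norm (s j + v j - s j))\<^sup>2"
      using curv[of d] unfolding h_def[symmetric] by (simp add: algebra_simps)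
  qed (use c v in auto)
qed

text \<open>For radius 0 the samples cannot move and the infimum over the multiplier need not be
  attained, hence the error \<eta>. The penalty has to dominate the quadratic part and, up to
  \<eta>, the linear part of the payoff around each sample.\<close>

lemma large_multiplier:
  fixes q :: "'b::euclidean_space \<Rightarrow> 'b"
  assumes lin: "bounded_linear q" and sym: "\<And>u v. u \<bullet> q v = q u \<bullet> v"
    and I: "finite I" and \<eta>: "\<eta> > 0"
  obtains l where "l \<ge> 0"
    and "\<And>j \<xi>. j \<in> I \<Longrightarrow> \<xi> \<bullet> q \<xi> + p \<bullet> \<xi> - l * (norm (\<xi> - s j))\<^sup>2
      \<le> s j \<bullet> q (s j) + p \<bullet> s j + \<eta>"
proof -
  interpret q: bounded_linear q
    by (rule lin)
  obtain B where B: "B \<ge> 0" "\<And>d. norm (q d) \<le> norm d * B"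
    using q.nonneg_bounded by blast
  define c where "c j = p + 2 *\<^sub>R q (s j)" for j
  \<comment> \<open>\<open>B\<close> dominates the quadratic part. Young's inequality trades the
    linear term \<open>c j \<bullet> d\<close> for \<eta> plus
    \<open>(norm (c j))\<^sup>2 / (4 * \<eta>)\<close> times the squared length of \<open>d\<close>;
    summing over \<open>j\<close> gives one multiplier for all samples.\<close>
  define l where "l = B + (\<Sum>j\<in>I. (norm (c j))\<^sup>2) / (4 * \<eta>)"
  show thesis
  proof
    show "l \<ge> 0"
      using B \<eta> by (auto simp: l_def intro!: add_nonneg_nonneg divide_nonneg_nonneg sum_nonneg)
  next
    fix j \<xi>
    assume j: "j \<in> I"
    define d where "d = \<xi> - s j"
    have "\<xi> = s j + d"
      by (simp add: d_def)
    moreover have "d \<bullet> q (s j) = q (s j) \<bullet> d" "s j \<bullet> q d = q (s j) \<bullet> d"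
      by (rule inner_commute, rule sym)
    ultimately have "\<xi> \<bullet> q \<xi> + p \<bullet> \<xi> = s j \<bullet> q (s j) + p \<bullet> s j + c j \<bullet> d + d \<bullet> q d"
      by (simp add: c_def q.add inner_add_left inner_add_right)
    moreover have "c j \<bullet> d \<le> \<eta> + (norm (c j))\<^sup>2 / (4 * \<eta>) * (norm d)\<^sup>2"
    proof -
      have "0 \<le> (norm (c j) * norm d - 2 * \<eta>)\<^sup>2"
        by simp
      then have "norm (c j) * norm d \<le> \<eta> + (norm (c j))\<^sup>2 / (4 * \<eta>) * (norm d)\<^sup>2"
        using \<eta> by (simp add: field_simps power2_eq_square)
      then show ?thesis
        using norm_cauchy_schwarz[of "c j" d] by linarith
    qed
    moreover have "d \<bullet> q d \<le> B * (norm d)\<^sup>2"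
    proof -
      have "d \<bullet> q d \<le> norm d * (norm d * B)"
        using norm_cauchy_schwarz[of d "q d"] B(2)[of d] by (meson mult_left_mono norm_ge_zero order_trans)
      then show ?thesis
        by (simp add: power2_eq_square mult_ac)
    qed
    moreover have "(B + (norm (c j))\<^sup>2 / (4 * \<eta>)) * (norm d)\<^sup>2 \<le> l * (norm d)\<^sup>2"
      using \<eta> I j unfolding l_def
      by (intro mult_right_mono add_left_mono divide_right_mono member_le_sum) auto
    ultimately show "\<xi> \<bullet> q \<xi> + p \<bullet> \<xi> - l * (norm (\<xi> - s j))\<^sup>2 \<le> s j \<bullet> q (s j) + p \<bullet> s j + \<eta>"
      by (simp add: d_def algebra_simps)
  qed
qed

section \<open>Comparison of the worst-case cost with the dual cost\<close>

text \<open>If some inner supremum is infinite, so is the dual cost. Otherwise the suprema are real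
  at all samples and serve as \<phi> in \<open>weak_duality\<close>.\<close>

lemma worst_case_cost_le_dual_cost:
  fixes Q :: "'a \<Rightarrow> real ^ 'm ^ 'm"
  assumes e: "\<epsilon> i \<ge> 0" and k: "K i \<ge> 1" and l: "l \<ge> 0"
    and g: "\<And>\<xi>. g i (x(i := y)) \<xi> = \<xi> \<bullet> (Q i *v \<xi>) + P i (x(i := y)) \<bullet> \<xi>"
  shows "worst_case_cost f g \<epsilon> K s i y x \<le> dual_cost f Q P \<epsilon> K s i y l x"
proof -
  define p where "p = P i (x(i := y))"
  define h where "h \<xi> = \<xi> \<bullet> (Q i *v \<xi>) + p \<bullet> \<xi>" for \<xi>
  define \<Phi> where "\<Phi> w = (SUP \<xi>. ereal (h \<xi> - l * (norm (\<xi> - w))\<^sup>2))" for w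
  have dual: "dual_cost f Q P \<epsilon> K s i y l x =
      ereal (f i (x(i := y)) + l * (\<epsilon> i)\<^sup>2) + ereal (1 / real (K i)) * (\<Sum>j=1..K i. \<Phi> (s i j))"
    by (simp add: dual_cost_def \<Phi>_def h_def p_def)
  have \<Phi>_upper: "ereal (h \<xi> - l * (norm (\<xi> - w))\<^sup>2) \<le> \<Phi> w" for \<xi> w
    unfolding \<Phi>_def by (rule SUP_upper) simp
  have h_cont: "continuous_on UNIV h"
    unfolding h_def by (intro continuous_intros linear_continuous_on matrix_vector_mul_bounded_linear)
  then have h_meas: "h \<in> borel_measurable borel"
    by (rule borel_measurable_continuous_onI)
  show ?thesis
  proof (cases "\<exists>j\<in>{1..K i}. \<Phi> (s i j) = \<infinity>")
    case True
    then have "(\<Sum>j=1..K i. \<Phi> (s i j)) = \<infinity>"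
      by (simp add: sum_Pinfty)
    then show ?thesis
      using k by (simp add: dual)
  next
    case False
    define \<phi> where "\<phi> w = real_of_ereal (\<Phi> w)" for w
    \<comment> \<open>Taking \<xi> equal to \<open>w\<close> bounds the supremum below by
      \<open>h w\<close>, which excludes the value -\<infinity>.\<close>
    have \<Phi>_eq: "\<Phi> w = ereal (\<phi> w)" if "w \<in> s i ` {1..K i}" for w
      using that False \<Phi>_upper[of w w] by (cases "\<Phi> w") (auto simp: \<phi>_def)
    then have bound: "h \<xi> \<le> \<phi> w + l * (norm (\<xi> - w))\<^sup>2" if "w \<in> s i ` {1..K i}" for \<xi> w
      using \<Phi>_upper[of \<xi> w] that by simp
    have "(\<Sum>j=1..K i. \<Phi> (s i j)) = ereal (\<Sum>j=1..K i. \<phi> (s i j))"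
      unfolding sum_ereal[symmetric] by (intro sum.cong refl \<Phi>_eq) auto
    then have dual_real: "dual_cost f Q P \<epsilon> K s i y l x =
        ereal (f i (x(i := y)) + (l * (\<epsilon> i)\<^sup>2 + (\<Sum>j=1..K i. \<phi> (s i j)) / real (K i)))"
      by (simp add: dual)
    obtain B where B: "B \<ge> 0" "\<And>d. norm (Q i *v d) \<le> norm d * B"
      using bounded_linear.nonneg_bounded[OF matrix_vector_mul_bounded_linear, of "Q i"] by blast
    \<comment> \<open>Quadratic growth and finite second moments make \<open>h\<close> integrable,
      so its Bochner integral is a genuine expectation and not the default 0.\<close>
    have h_bound: "\<bar>h \<xi>\<bar> \<le> (B + norm p) * (norm \<xi>)\<^sup>2 + norm p" for \<xi>
    proof -
      have "\<bar>\<xi> \<bullet> (Q i *v \<xi>)\<bar> \<le> norm \<xi> * (norm \<xi> * B)"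
        using Cauchy_Schwarz_ineq2 B(2) by (meson mult_left_mono norm_ge_zero order_trans)
      moreover have "norm \<xi> \<le> (norm \<xi>)\<^sup>2 + 1"
        using zero_le_power2[of "norm \<xi> - 1"] by (simp add: power2_diff) (use norm_ge_zero[of \<xi>] in linarith)
      then have "\<bar>p \<bullet> \<xi>\<bar> \<le> norm p * ((norm \<xi>)\<^sup>2 + 1)"
        using Cauchy_Schwarz_ineq2 by (meson mult_left_mono norm_ge_zero order_trans)
      ultimately show ?thesis
        unfolding h_def by (simp add: algebra_simps power2_eq_square)
    qed
    have "ereal (f i (x(i := y)) + (\<integral>\<xi>. g i (x(i := y)) \<xi> \<partial>M)) \<le> dual_cost f Q P \<epsilon> K s i y l x"
      if M: "M \<in> ambiguity_set (\<epsilon> i) (K i) (s i)" for M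
    proof -
      have sets_M: "sets M = sets borel" and "prob_space M"
        using M by (auto simp: ambiguity_set_def)
      interpret prob_space M
        by fact
      have "integrable M (\<lambda>\<xi>. (B + norm p) * (norm \<xi>)\<^sup>2 + norm p)"
        using ambiguity_set_integrable_norm_square[OF M e] by simp
      then have "integrable M h"
        by (rule Bochner_Integration.integrable_bound)
          (use h_meas h_bound sets_M in \<open>auto cong: measurable_cong_sets intro!: AE_I2 intro: order_trans[OF _ abs_ge_self]\<close>)
      from weak_duality[OF M e l this h_meas bound] show ?thesis
        by (simp add: dual_real g h_def p_def)
    qed
    then show ?thesis
      unfolding worst_case_cost_def by (rule SUP_least)
  qed
qed

text \<open>The empirical measure of the moved samples \<open>t\<close> is the near-optimal
  adversary. The samples use up the transport budget exactly, so the penalties cancel the term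
  \<open>l * (\<epsilon> i)\<^sup>2\<close> of the dual cost (complementary slackness).\<close>

lemma dual_cost_le_worst_case_cost:
  fixes Q :: "'a \<Rightarrow> real ^ 'm ^ 'm"
  assumes e: "\<epsilon> i \<ge> 0" and k: "K i \<ge> 1" and Q: "positive_semidefinite (Q i)"
    and g: "\<And>\<xi>. g i (x(i := y)) \<xi> = \<xi> \<bullet> (Q i *v \<xi>) + P i (x(i := y)) \<bullet> \<xi>"
    and \<eta>: "\<eta> > 0"
  obtains l where "l \<ge> 0"
    and "dual_cost f Q P \<epsilon> K s i y l x \<le> worst_case_cost f g \<epsilon> K s i y x + ereal \<eta>"
proof -
  define p where "p = P i (x(i := y))"
  define h where "h \<xi> = \<xi> \<bullet> (Q i *v \<xi>) + p \<bullet> \<xi>" for \<xi>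
  have sym: "u \<bullet> (Q i *v v) = (Q i *v u) \<bullet> v" for u v
    using Q by (metis dot_lmul_matrix positive_semidefinite_def vector_transpose_matrix)
  have psd: "0 \<le> v \<bullet> (Q i *v v)" for v
    using Q by (simp add: positive_semidefinite_def)
  \<comment> \<open>A common form for both cases: for radius 0 the samples stay put and \<eta> is
    really spent, for positive radius the maximality is exact and \<eta> is merely added.\<close>
  obtain l t where l: "l \<ge> 0"
    and cost: "(\<Sum>j=1..K i. (norm (t j - s i j))\<^sup>2) = real (K i) * (\<epsilon> i)\<^sup>2"
    and opt: "\<And>j \<xi>. j \<in> {1..K i} \<Longrightarrow>
      h \<xi> - l * (norm (\<xi> - s i j))\<^sup>2 \<le> h (t j) - l * (norm (t j - s i j))\<^sup>2 + \<eta>"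
  proof (cases "\<epsilon> i = 0")
    case True
    obtain l where "l \<ge> 0" "\<And>j \<xi>. j \<in> {1..K i} \<Longrightarrow> h \<xi> - l * (norm (\<xi> - s i j))\<^sup>2 \<le> h (s i j) + \<eta>"
      using large_multiplier[where q = "(*v) (Q i)" and p = p and s = "s i" and I = "{1..K i}" and \<eta> = \<eta>]
        matrix_vector_mul_bounded_linear sym \<eta> finite_atLeastAtMost unfolding h_def by blast
    then show thesis
      using True by (intro that[of l "s i"]) auto
  next
    case False
    then have "real (K i) * (\<epsilon> i)\<^sup>2 > 0" "{1..K i} \<noteq> {}"
      using k by auto
    then obtain l t where "l \<ge> 0" "(\<Sum>j=1..K i. (norm (t j - s i j))\<^sup>2) = real (K i) * (\<epsilon> i)\<^sup>2"
      "\<And>j \<xi>. j \<in> {1..K i} \<Longrightarrow>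
        h \<xi> - l * (norm (\<xi> - s i j))\<^sup>2 \<le> h (t j) - l * (norm (t j - s i j))\<^sup>2"
      using trust_region_multiplier[where q = "(*v) (Q i)" and p = p and s = "s i" and I = "{1..K i}"
          and R = "real (K i) * (\<epsilon> i)\<^sup>2"]
        matrix_vector_mul_bounded_linear sym psd finite_atLeastAtMost unfolding h_def by blast
    then show thesis
      using \<eta> by (intro that[of l t]) (auto intro: add_increasing2)
  qed
  have "(\<Sum>j=1..K i. SUP \<xi>. ereal (h \<xi> - l * (norm (\<xi> - s i j))\<^sup>2))
      \<le> (\<Sum>j=1..K i. ereal (h (t j) - l * (norm (t j - s i j))\<^sup>2 + \<eta>))"
    by (intro sum_mono SUP_least) (simp add: opt)
  also have "\<dots> = ereal ((\<Sum>j=1..K i. h (t j)) - l * (real (K i) * (\<epsilon> i)\<^sup>2) + real (K i) * \<eta>)"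
    by (simp add: sum.distrib sum_subtractf sum_distrib_left[symmetric] cost[unfolded One_nat_def])
  finally have "dual_cost f Q P \<epsilon> K s i y l x \<le> ereal (f i (x(i := y)) + l * (\<epsilon> i)\<^sup>2) +
      ereal (1 / real (K i)) * ereal ((\<Sum>j=1..K i. h (t j)) - l * (real (K i) * (\<epsilon> i)\<^sup>2) + real (K i) * \<eta>)"
    unfolding dual_cost_def p_def[symmetric] h_def[symmetric]
    by (intro add_left_mono ereal_mult_left_mono) auto
  also have "\<dots> = ereal (f i (x(i := y)) + (\<Sum>j=1..K i. h (t j)) / real (K i)) + ereal \<eta>"
    using k by (simp add: field_simps)
  also have "(\<Sum>j=1..K i. h (t j)) / real (K i) = (\<integral>\<xi>. g i (x(i := y)) \<xi> \<partial>empirical_measure (K i) t)"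
  proof -
    have "h \<in> borel_measurable borel"
      unfolding h_def
      by (intro borel_measurable_continuous_onI continuous_intros linear_continuous_on
          matrix_vector_mul_bounded_linear)
    then have "(\<integral>\<xi>. h \<xi> \<partial>empirical_measure (K i) t) = (\<Sum>j=1..K i. h (t j)) / real (K i)"
      by (rule integral_empirical_measure)
    then show ?thesis
      by (simp add: g h_def p_def)
  qed
  \<comment> \<open>The moved samples form a feasible distribution, so their expected cost is below
    the supremum.\<close>
  also have "ereal (f i (x(i := y)) + (\<integral>\<xi>. g i (x(i := y)) \<xi> \<partial>empirical_measure (K i) t))
      \<le> worst_case_cost f g \<epsilon> K s i y x"
    unfolding worst_case_cost_def using cost
    by (intro SUP_upper empirical_measure_in_ambiguity_set k e) simp
  finally show thesis
    using that l by (simp add: add_right_mono)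
qed

section \<open>Positive semidefiniteness of \<open>Q i\<close> and the equilibrium\<close>

lemma positive_semidefinite_congruence:
  assumes "positive_semidefinite D"
  shows "positive_semidefinite (transpose L ** D ** L)"
  unfolding positive_semidefinite_def
proof (intro conjI allI)
  show "transpose (transpose L ** D ** L) = transpose L ** D ** L"
    using assms by (simp add: positive_semidefinite_def matrix_transpose_mul matrix_mul_assoc)
  fix v
  have "v \<bullet> ((transpose L ** D ** L) *v v) = (L *v v) \<bullet> (D *v (L *v v))"
    by (metis dot_lmul_matrix matrix_vector_mul_assoc vector_transpose_matrix)
  then show "0 \<le> v \<bullet> ((transpose L ** D ** L) *v v)"
    using assms by (simp add: positive_semidefinite_def)
qed

theorem lemma3p2:
  fixes X :: "'a::finite \<Rightarrow> (real ^ 'n) set"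
    and f :: "'a \<Rightarrow> ('a \<Rightarrow> real ^ 'n) \<Rightarrow> real"
    and g :: "'a \<Rightarrow> ('a \<Rightarrow> real ^ 'n) \<Rightarrow> real ^ 'm::{finite,linorder} \<Rightarrow> real"
    and \<epsilon> :: "'a \<Rightarrow> real"
    and K :: "'a \<Rightarrow> nat"
    and s :: "'a \<Rightarrow> nat \<Rightarrow> real ^ 'm::{finite,linorder}"
    and P :: "'a \<Rightarrow> ('a \<Rightarrow> real ^ 'n) \<Rightarrow> real ^ 'm::{finite,linorder}"
    and A :: "'a \<Rightarrow> real ^ ('a \<times> 'n) ^ 'm::{finite,linorder}"
    and b :: "'a \<Rightarrow> real ^ 'm::{finite,linorder}"
    and Q L D :: "'a \<Rightarrow> real ^ 'm::{finite,linorder} ^ 'm::{finite,linorder}"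
    and x :: "'a \<Rightarrow> real ^ 'n"
    and l :: "'a \<Rightarrow> real"
  assumes radius: "\<And>i. \<epsilon> i \<ge> 0"
    and samples: "\<And>i. K i \<ge> 1"
    and f_convex: "\<And>i z. (\<And>j. j \<noteq> i \<Longrightarrow> z j \<in> X j) \<Longrightarrow>
                     convex_on UNIV (\<lambda>y. f i (z(i := y)))"
    and g_eq: "\<And>i z \<xi>. g i z \<xi> = \<xi> \<bullet> (Q i *v \<xi>) + P i z \<bullet> \<xi>"
    and P_eq: "\<And>i z. P i z = A i *v stack z + b i"
    and Q_eq: "\<And>i. Q i = transpose (L i) ** D i ** L i"
    and L_orth: "\<And>i. orthogonal_matrix (L i)"
    and D_diag: "\<And>i. diagonal_matrix (D i)"
    and D_psd: "\<And>i. positive_semidefinite (D i)"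
    and D_sorted: "\<And>i. sorted_diagonal (D i)"
    and equilibrium: "robust_nash_equilibrium X f Q P \<epsilon> K s x l"
  shows "dr_nash_equilibrium X f g \<epsilon> K s x"
proof -
  have dual_min: "dual_cost f Q P \<epsilon> K s i (x i) (l i) x \<le> dual_cost f Q P \<epsilon> K s i y l' x"
    if "y \<in> X i" "l' \<ge> 0" for i y l'
    using equilibrium that unfolding robust_nash_equilibrium_def is_arg_min_def
    by (fastforce simp: not_less[symmetric])
  have feasible: "x i \<in> X i" "l i \<ge> 0" for i
    using equilibrium by (auto simp: robust_nash_equilibrium_def is_arg_min_def)
  have "worst_case_cost f g \<epsilon> K s i (x i) x \<le> worst_case_cost f g \<epsilon> K s i y x"
    if y: "y \<in> X i" for i y
  \<comment> \<open>An arbitrary slack \<eta> is enough, and it is needed where strong duality holds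
    only as an infimum over multipliers.\<close>
  proof (rule ereal_le_epsilon2)
    fix \<eta> :: real
    assume "\<eta> > 0"
    then obtain l' where l': "l' \<ge> 0"
      "dual_cost f Q P \<epsilon> K s i y l' x \<le> worst_case_cost f g \<epsilon> K s i y x + ereal \<eta>"
      using dual_cost_le_worst_case_cost[of \<epsilon> i K Q g x y P \<eta> f s] radius samples g_eq
        positive_semidefinite_congruence[OF D_psd] Q_eq by metis
    have "worst_case_cost f g \<epsilon> K s i (x i) x \<le> dual_cost f Q P \<epsilon> K s i (x i) (l i) x"
      by (intro worst_case_cost_le_dual_cost radius samples feasible g_eq)
    also note dual_min[OF y l'(1)]
    also note l'(2)
    finally show "worst_case_cost f g \<epsilon> K s i (x i) x \<le> worst_case_cost f g \<epsilon> K s i y x + ereal \<eta>" .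
  qed
  then show ?thesis
    by (auto simp: dr_nash_equilibrium_def is_arg_min_def feasible not_less)
qed

end
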